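(* Let $\alpha>0$ and $0<p,q\le\infty$. There is a constant $C>0$ depending only on $\alpha$ and $q$ such that for every $f\in\mathcal F_\alpha^{p,q}$, $$M_p(f,r)\le C\,(1+r)^{-\frac1q}e^{\frac{\alpha}{2}r^2}\,\|f\|_{\mathcal F_\alpha^{p,q}},\qquad r\ge 0,$$ with the convention $\frac1\infty=0$.
   Context: For an entire function $f$ and $r\ge0$, $M_p(f,r):=\left(\frac1{2\pi}\int_0^{2\pi}|f(re^{i\theta})|^p\,d\theta\right)^{1/p}$ for $0<p<\infty$, and $M_\infty(f,r):=\sup_{\theta\in[0,2\pi]}|f(re^{i\theta})|$. For $\alpha>0$ put $$\|f\|_{\mathcal F_\alpha^{p,q}}:=\left(\int_0^\infty M_p(f,r)^q\,\alpha q\,e^{-\frac{\alpha q}{2}r^2}r\,dr\right)^{1/q}\ (0<q<\infty),\qquad \|f\|_{\mathcal F_\alpha^{p,\infty}}:=\sup_{r\ge0}M_p(f,r)e^{-\frac{\alpha}{2}r^2}.$$ The mixed-norm Fock space $\mathcal F_\alpha^{p,q}$ is the set of entire functions $f$ on $\mathbb C$ with $\|f\|_{\mathcal F_\alpha^{p,q}}<\infty$. *)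

theory Defs
  imports "HOL-Complex_Analysis.Complex_Analysis"
begin

text \<open>
  Exponents range over \<open>(0, \<infinity>]\<close> and are represented as positive elements of \<^typ>\<open>ennreal\<close>.
\<close>

definition integral_mean :: "ennreal \<Rightarrow> (complex \<Rightarrow> complex) \<Rightarrow> real \<Rightarrow> real" where
  "integral_mean p f r =
     (if p = \<infinity> then (SUP \<theta>\<in>{0..2*pi}. cmod (f (of_real r * exp (\<i> * of_real \<theta>))))
      else (1 / (2*pi) *
             integral {0..2*pi} (\<lambda>\<theta>. cmod (f (of_real r * exp (\<i> * of_real \<theta>))) powr enn2real p))
           powr (1 / enn2real p))"

text \<open>Power of an extended nonnegative real, for exponents \<open>a > 0\<close> only.\<close>

definition ennreal_powr :: "ennreal \<Rightarrow> real \<Rightarrow> ennreal" where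
  "ennreal_powr x a = (if x = \<infinity> then \<infinity> else ennreal (enn2real x powr a))"

text \<open>
  The norm takes values in \<open>[0, \<infinity>]\<close>, so that membership in the space is literally
  finiteness of the norm.
\<close>

definition fock_norm :: "real \<Rightarrow> ennreal \<Rightarrow> ennreal \<Rightarrow> (complex \<Rightarrow> complex) \<Rightarrow> ennreal" where
  "fock_norm \<alpha> p q f =
     (if q = \<infinity> then (SUP r\<in>{0..}. ennreal (integral_mean p f r * exp (- (\<alpha> / 2) * r\<^sup>2)))
      else ennreal_powr
        (\<integral>\<^sup>+ r\<in>{0..}. ennreal (integral_mean p f r powr enn2real q *
             (\<alpha> * enn2real q) * exp (- (\<alpha> * enn2real q / 2) * r\<^sup>2) * r) \<partial>lborel)
        (1 / enn2real q))"

definition mixed_fock_space :: "real \<Rightarrow> ennreal \<Rightarrow> ennreal \<Rightarrow> (complex \<Rightarrow> complex) set" where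
  "mixed_fock_space \<alpha> p q = {f. f holomorphic_on UNIV \<and> fock_norm \<alpha> p q f < \<infinity>}"

end

theory Submission
  imports Defs
begin

text \<open>
  Besides being increasing in \<open>r\<close>, the mean \<open>M r\<close> satisfies Hardy's convexity
  \<open>(M (sqrt (a b)))\<^sup>2 \<le> M a * M b\<close>. With \<open>R = sqrt (r\<^sup>2 + 1)\<close> and \<open>0 \<le> u \<le> 1/2\<close> these give
  \<open>(M r)\<^sup>2 \<le> M (R - u) * M (R + u)\<close>, where the Gaussian weights at \<open>r\<close> and \<open>R \<plusminus> u\<close> match up
  to a constant. Taking \<open>q\<close>-th powers, applying AM-GM and averaging over \<open>u\<close> bounds
  the weighted \<open>(M r)\<^sup>q\<close> by an integral over a unit interval on which the factor \<open>s\<close> in the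
  measure \<open>s ds\<close> is comparable to \<open>1 + r\<close>, which is the source of the gain \<open>(1 + r) powr (- 1/q)\<close>.

  Both properties of \<open>M\<close> come from the maximum principle for finite sums \<open>\<Sum>j. \<bar>G j\<bar> powr a\<close>
  with holomorphic \<open>G j\<close>, by approximating the circle integrals with equidistant Riemann sums.
\<close>

subsection \<open>A maximum principle\<close>

text \<open>Near \<open>w\<close>, each \<open>G j\<close> with \<open>G j w \<noteq> 0\<close>,
  divided by its value at \<open>w\<close>, has a holomorphic power with exponent \<open>a\<close>.
  The weighted sum \<open>H\<close> of these powers agrees with the real sum at \<open>w\<close> and
  is bounded by it in modulus, so the maximum modulus principle makes \<open>H\<close> constant and
  squeezes the sum.\<close>

lemma sum_norm_powr_locally_const_at_max:
  fixes G :: "'i \<Rightarrow> complex \<Rightarrow> complex"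
  assumes S: "open S" "w \<in> S" and J: "finite J"
    and hol: "\<And>j. j \<in> J \<Longrightarrow> G j holomorphic_on S"
    and max: "\<And>z. z \<in> S \<Longrightarrow> (\<Sum>j\<in>J. cmod (G j z) powr a) \<le> (\<Sum>j\<in>J. cmod (G j w) powr a)"
  obtains e where "e > 0" "ball w e \<subseteq> S"
    "\<And>z. z \<in> ball w e \<Longrightarrow> (\<Sum>j\<in>J. cmod (G j z) powr a) = (\<Sum>j\<in>J. cmod (G j w) powr a)"
proof -
  define u where "u z = (\<Sum>j\<in>J. cmod (G j z) powr a)" for z
  define J' where "J' = {j\<in>J. G j w \<noteq> 0}"
  have "finite J'" using J by (auto simp: J'_def)
  have "\<forall>\<^sub>F z in nhds w. dist (G j z) (G j w) < cmod (G j w)" if "j \<in> J'" for j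
  proof -
    have "isCont (G j) w"
      using holomorphic_on_imp_continuous_on[OF hol] S that continuous_on_eq_continuous_at
      by (auto simp: J'_def)
    then have "(G j \<longlongrightarrow> G j w) (nhds w)"
      by (simp add: isCont_def tendsto_at_iff_tendsto_nhds)
    then show ?thesis
      using tendstoD[of "G j"] that by (auto simp: J'_def)
  qed
  then have "\<forall>\<^sub>F z in nhds w. (\<forall>j\<in>J'. dist (G j z) (G j w) < cmod (G j w)) \<and> z \<in> S"
    using \<open>finite J'\<close> S by (intro eventually_conj eventually_ball_finite eventually_nhds_in_open) auto
  then obtain e where e: "e > 0"
    "\<And>z. dist z w < e \<Longrightarrow> (\<forall>j\<in>J'. dist (G j z) (G j w) < cmod (G j w)) \<and> z \<in> S"
    unfolding eventually_nhds_metric by blast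
  have sub: "ball w e \<subseteq> S"
    using e(2) by (auto simp: dist_commute)
  \<comment> \<open>A quotient \<open>t \<le> 0\<close> would put \<open>G j z\<close> at distance
    \<open>(1 - t) * cmod (G j w)\<close> from \<open>G j w\<close>, outside the disc secured by
    continuity. Hence the branch cut of \<open>powr\<close> is avoided.\<close>
  have slit: "G j z / G j w \<notin> \<real>\<^sub>\<le>\<^sub>0" if "j \<in> J'" "z \<in> ball w e" for j z
  proof
    assume "G j z / G j w \<in> \<real>\<^sub>\<le>\<^sub>0"
    then obtain t where t: "t \<le> 0" "G j z / G j w = of_real t"
      by (auto simp: nonpos_Reals_def)
    have 0: "G j w \<noteq> 0" using that by (auto simp: J'_def)
    have "dist (G j z) (G j w) < cmod (G j w)"
      using e(2)[of z] that by (simp add: dist_commute)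
    moreover have "G j z - G j w = of_real (t - 1) * G j w"
      using t 0 by (simp add: field_simps)
    then have "dist (G j z) (G j w) = \<bar>t - 1\<bar> * cmod (G j w)"
      by (simp add: dist_norm norm_mult del: of_real_diff)
    moreover have "1 * cmod (G j w) \<le> \<bar>t - 1\<bar> * cmod (G j w)"
      using t by (intro mult_right_mono) auto
    ultimately show False by simp
  qed
  \<comment> \<open>a holomorphic minorant of the sum in modulus, touching it at \<open>w\<close>\<close>
  define H where "H z = (\<Sum>j\<in>J'. of_real (cmod (G j w) powr a) * (G j z / G j w) powr of_real a)" for z
  have "H holomorphic_on ball w e"
    unfolding H_def using slit sub
    by (intro holomorphic_intros holomorphic_on_subset[OF hol]) (auto simp: J'_def)
  have Hw: "H w = of_real (u w)"
  proof -
    have "H w = (\<Sum>j\<in>J'. of_real (cmod (G j w) powr a))"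
      unfolding H_def by (intro sum.cong) (auto simp: J'_def)
    \<comment> \<open>The added terms have \<open>G j w = 0\<close> and vanish because
      \<open>0 powr a = 0\<close> for every \<open>a\<close>.\<close>
    also have "\<dots> = (\<Sum>j\<in>J. of_real (cmod (G j w) powr a))"
      using J by (intro sum.mono_neutral_left) (auto simp: J'_def)
    finally show ?thesis by (simp add: u_def)
  qed
  have Hz: "cmod (H z) \<le> u z" if "z \<in> ball w e" for z
  proof -
    have "cmod (H z) \<le> (\<Sum>j\<in>J'. cmod (G j z) powr a)"
      unfolding H_def
    proof (intro sum_norm_le)
      fix j assume "j \<in> J'"
      then have "G j w \<noteq> 0" by (auto simp: J'_def)
      then show "cmod (of_real (cmod (G j w) powr a) * (G j z / G j w) powr of_real a)
          \<le> cmod (G j z) powr a"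
        by (simp add: norm_mult norm_powr_real_powr' norm_divide powr_mult[symmetric])
    qed
    also have "\<dots> \<le> u z"
      unfolding u_def using J by (intro sum_mono2) (auto simp: J'_def)
    finally show ?thesis .
  qed
  have "cmod (H w) = u w"
    by (simp add: Hw norm_of_real u_def sum_nonneg del: of_real_sum)
  have "H constant_on ball w e"
  proof (rule maximum_modulus_principle[where U = "ball w e" and \<xi> = w])
    show "cmod (H z) \<le> cmod (H w)" if "z \<in> ball w e" for z
      using Hz[OF that] max[of z] sub that \<open>cmod (H w) = u w\<close> by (auto simp: u_def)
  qed (use \<open>H holomorphic_on ball w e\<close> e in auto)
  then have Hc: "H z = H w" if "z \<in> ball w e" for z
    using that e(1) unfolding constant_on_def by (metis centre_in_ball)
  have "u z = u w" if "z \<in> ball w e" for z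
  proof (rule antisym)
    show "u z \<le> u w" using max[of z] sub that by (auto simp: u_def)
    show "u w \<le> u z" using Hz[OF that] Hc[OF that] \<open>cmod (H w) = u w\<close> by simp
  qed
  then show ?thesis
    using that e(1) sub unfolding u_def by blast
qed

text \<open>The set \<open>T\<close> of maximum points is compact and, by local constancy, contains
  a disc around each of its points interior to \<open>K\<close>. A point of \<open>T\<close> that is
  extreme in some direction therefore lies on the frontier.\<close>

lemma sum_norm_powr_le_frontier:
  fixes G :: "'i \<Rightarrow> complex \<Rightarrow> complex"
  assumes K: "compact K" "z \<in> K" and J: "finite J" and a: "a > 0"
    and cont: "\<And>j. j \<in> J \<Longrightarrow> continuous_on K (G j)"
    and hol: "\<And>j. j \<in> J \<Longrightarrow> G j holomorphic_on interior K"
  obtains w where "w \<in> frontier K"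
    "(\<Sum>j\<in>J. cmod (G j z) powr a) \<le> (\<Sum>j\<in>J. cmod (G j w) powr a)"
proof -
  define u where "u z = (\<Sum>j\<in>J. cmod (G j z) powr a)" for z
  have u: "continuous_on K u"
    unfolding u_def using a by (intro continuous_intros continuous_on_powr' cont) auto
  obtain x where x: "x \<in> K" "\<And>y. y \<in> K \<Longrightarrow> u y \<le> u x"
    using continuous_attains_sup[OF K(1) _ u] K(2) by blast
  define T where "T = {y\<in>K. u y = u x}"
  have "closed T"
    unfolding T_def using continuous_closed_preimage_constant[OF u compact_imp_closed[OF K(1)]] by simp
  then have "compact T"
    using K(1) compact_Int_closed[of K T] by (simp add: T_def Int_absorb1 Int_def)
  moreover have "x \<in> T" using x by (simp add: T_def)
  \<comment> \<open>the maximum point with the largest real part cannot be interior\<close>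
  ultimately obtain w where w: "w \<in> T" "\<And>y. y \<in> T \<Longrightarrow> Re y \<le> Re w"
    using continuous_attains_sup[of T Re] continuous_on_Re[OF continuous_on_id] by blast
  have "w \<notin> interior K"
  proof
    assume int: "w \<in> interior K"
    have umax: "u y \<le> u w" if "y \<in> interior K" for y
      using that w x interior_subset by (auto simp: T_def)
    obtain e where e: "e > 0" "ball w e \<subseteq> interior K"
      "\<And>z. z \<in> ball w e \<Longrightarrow> u z = u w"
      using sum_norm_powr_locally_const_at_max[OF open_interior int J hol umax[unfolded u_def], folded u_def]
      by blast
    have "w + of_real (e/2) \<in> ball w e"
      using e(1) by (simp add: dist_norm)
    then have "w + of_real (e/2) \<in> T"
      using e(2,3) w(1) interior_subset[of K] by (auto simp: T_def)
    then show False
      using w(2)[of "w + of_real (e/2)"] e(1) by simp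
  qed
  then have "w \<in> frontier K"
    using w K(1) by (simp add: T_def frontier_def compact_imp_closed)
  moreover have "u z \<le> u w"
    using w x K(2) by (simp add: T_def)
  ultimately show ?thesis
    using that unfolding u_def by blast
qed

subsection \<open>Equidistant Riemann sums\<close>

text \<open>Induction over the cells: each cell of length \<open>h\<close> adds at most
  \<open>h * e\<close>, since \<open>u\<close> differs there from its value at the left endpoint by
  at most \<open>e\<close>.\<close>

lemma riemann_sum_error:
  fixes u :: "real \<Rightarrow> real"
  assumes h: "h \<ge> 0" and u: "continuous_on {a..a + real n * h} u"
    and osc: "\<And>x y. \<lbrakk>x \<in> {a..a + real n * h}; y \<in> {a..a + real n * h}; \<bar>x - y\<bar> \<le> h\<rbrakk> \<Longrightarrow> \<bar>u x - u y\<bar> \<le> e"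
  shows "\<bar>(\<Sum>j<n. h * u (a + real j * h)) - integral {a..a + real n * h} u\<bar> \<le> real n * h * e"
  using u osc
proof (induction n)
  case (Suc n)
  let ?b = "a + real n * h" and ?c = "a + real (Suc n) * h"
  have le: "a \<le> ?b" "?b \<le> ?c" using h by (auto simp: algebra_simps)
  have IH: "\<bar>(\<Sum>j<n. h * u (a + real j * h)) - integral {a..?b} u\<bar> \<le> real n * h * e"
    using le by (intro Suc.IH Suc.prems(2) continuous_on_subset[OF Suc.prems(1)]) auto
  have int: "u integrable_on {a..?c}"
    using Suc.prems(1) by (rule integrable_continuous_real)
  have int': "u integrable_on {?b..?c}"
    using le by (intro integrable_continuous_real continuous_on_subset[OF Suc.prems(1)]) auto
  have "h * u ?b - integral {?b..?c} u = integral {?b..?c} (\<lambda>x. u ?b - u x)"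
    using le int' by (subst integral_diff) (auto simp: algebra_simps)
  also have "norm \<dots> \<le> e * (?c - ?b)"
  proof (rule integral_bound)
    show "continuous_on {?b..?c} (\<lambda>x. u ?b - u x)"
      using le by (intro continuous_intros continuous_on_subset[OF Suc.prems(1)]) auto
    show "norm (u ?b - u t) \<le> e" if "t \<in> {?b..?c}" for t
    proof -
      have "?c = ?b + h" by (simp add: algebra_simps)
      then show ?thesis
        unfolding real_norm_def using le h that
        by (intro Suc.prems(2)) (auto intro: order_trans[OF le(1)])
    qed
  qed (use le in auto)
  finally have "\<bar>h * u ?b - integral {?b..?c} u\<bar> \<le> h * e"
    by (simp add: algebra_simps)
  moreover have "integral {a..?b} u + integral {?b..?c} u = integral {a..?c} u"
    using le int by (intro Henstock_Kurzweil_Integration.integral_combine) auto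
  ultimately show ?case
    using IH by (simp add: algebra_simps abs_le_iff)
qed auto

text \<open>Serves to discard the starting point of the sample points; the piece beyond
  \<open>T\<close> is translated back onto \<open>{0..s}\<close>.\<close>

lemma integral_period_shift:
  fixes u :: "real \<Rightarrow> real"
  assumes u: "continuous_on UNIV u" and per: "\<And>x. u (x + T) = u x" and s: "s \<in> {0..T}"
  shows "integral {s..s + T} u = integral {0..T} u"
proof -
  have int: "u integrable_on {x..y}" for x y
    using u continuous_on_subset integrable_continuous_real by blast
  have "((\<lambda>x. u (x + T)) has_integral integral {T..s + T} u) {T - T..s + T - T}"
    using integrable_integral[OF int] by (rule has_integral_shift_real_ivl)
  then have "integral {T..s + T} u = integral {0..s} u"
    by (simp add: per integral_unique)
  moreover have "integral {s..T} u + integral {T..s + T} u = integral {s..s + T} u"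
    using s int by (intro Henstock_Kurzweil_Integration.integral_combine) auto
  moreover have "integral {0..s} u + integral {s..T} u = integral {0..T} u"
    using s int by (intro Henstock_Kurzweil_Integration.integral_combine) auto
  ultimately show ?thesis by simp
qed

text \<open>The shift \<open>s\<close> may vary with \<open>n\<close> without any control. Uniform
  continuity bounds the Riemann sum error independently of the starting point, and periodicity of
  \<open>w\<close> makes the integral independent of it.\<close>

lemma integral_le_of_equidistant_sums_le:
  fixes u w :: "real \<Rightarrow> real"
  assumes T: "T > 0" and u: "continuous_on UNIV u" and w: "continuous_on UNIV w"
    and per: "\<And>x. w (x + T) = w x"
    and le: "\<And>n::nat. n > 0 \<Longrightarrow>
      \<exists>s\<in>{0..T}. (\<Sum>j<n. u (real j * (T / n))) \<le> (\<Sum>j<n. w (s + real j * (T / n)))"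
  shows "integral {0..T} u \<le> integral {0..T} w"
proof (rule field_le_epsilon)
  fix d :: real assume "d > 0"
  \<comment> \<open>Two Riemann sum errors of at most \<open>T * e = d / 2\<close> each add up to
    \<open>d\<close>.\<close>
  define e where "e = d / (2 * T)"
  have "e > 0" using T \<open>d > 0\<close> by (simp add: e_def)
  \<comment> \<open>\<open>{0..2*T}\<close> contains every window \<open>{s..s + T}\<close> with
    \<open>s \<in> {0..T}\<close>.\<close>
  have unif: "\<exists>h>0. \<forall>x\<in>{0..2*T}. \<forall>y\<in>{0..2*T}. dist x y < h \<longrightarrow> dist (f x) (f y) < e"
    if "continuous_on UNIV f" for f :: "real \<Rightarrow> real"
    using compact_uniformly_continuous[OF continuous_on_subset[OF that, of "{0..2*T}"]] \<open>e > 0\<close>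
    unfolding uniformly_continuous_on_def by (metis compact_Icc dist_commute top_greatest)
  obtain h1 h2 where h: "h1 > 0" "h2 > 0"
    and h1: "\<And>x y. \<lbrakk>x \<in> {0..2*T}; y \<in> {0..2*T}; dist x y < h1\<rbrakk> \<Longrightarrow> dist (u x) (u y) < e"
    and h2: "\<And>x y. \<lbrakk>x \<in> {0..2*T}; y \<in> {0..2*T}; dist x y < h2\<rbrakk> \<Longrightarrow> dist (w x) (w y) < e"
    using unif[OF u] unif[OF w] by blast
  obtain n where n: "real n > T / min h1 h2" using reals_Archimedean2 by blast
  have "n > 0" using n h T by (metis divide_pos_pos min_less_iff_conj not_less_iff_gr_or_eq of_nat_0 gr0I)
  define k where "k = T / n"
  have k: "k > 0" "k < h1" "k < h2" "real n * k = T"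
  proof -
    have "T < real n * min h1 h2" using n h by (simp add: pos_divide_less_eq)
    then have "k < min h1 h2" using \<open>n > 0\<close> by (simp only: k_def pos_divide_less_eq of_nat_0_less_iff mult.commute)
    then show "k < h1" "k < h2" by linarith+
  qed (use T \<open>n > 0\<close> in \<open>auto simp: k_def\<close>)
  obtain s where s: "s \<in> {0..T}" "(\<Sum>j<n. u (real j * k)) \<le> (\<Sum>j<n. w (s + real j * k))"
    using le[OF \<open>n > 0\<close>] by (auto simp: k_def)
  have "\<bar>(\<Sum>j<n. k * u (0 + real j * k)) - integral {0..0 + real n * k} u\<bar> \<le> real n * k * e"
  proof (rule riemann_sum_error)
    show "\<bar>u x - u y\<bar> \<le> e" if "x \<in> {0..0 + real n * k}" "y \<in> {0..0 + real n * k}" "\<bar>x - y\<bar> \<le> k" for x y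
      using h1[of x y] that k T by (auto simp: dist_real_def)
  qed (use k u continuous_on_subset in auto)
  moreover have "\<bar>(\<Sum>j<n. k * w (s + real j * k)) - integral {s..s + real n * k} w\<bar> \<le> real n * k * e"
  proof (rule riemann_sum_error)
    show "\<bar>w x - w y\<bar> \<le> e" if "x \<in> {s..s + real n * k}" "y \<in> {s..s + real n * k}" "\<bar>x - y\<bar> \<le> k" for x y
      using h2[of x y] that k T s by (auto simp: dist_real_def)
  qed (use k w continuous_on_subset in auto)
  moreover have "(\<Sum>j<n. k * u (real j * k)) \<le> (\<Sum>j<n. k * w (s + real j * k))"
    using s k by (simp add: sum_distrib_left[symmetric])
  moreover have "integral {s..s + T} w = integral {0..T} w"
    using w per s by (intro integral_period_shift) auto
  moreover have "T * e = d / 2"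
    using T by (simp add: e_def)
  ultimately show "integral {0..T} u \<le> integral {0..T} w + d"
    unfolding k(4) by (simp only: abs_le_iff add_0) linarith
qed

subsection \<open>Integral means of entire functions\<close>

lemma exists_circle_angle:
  assumes "cmod w = R"
  obtains s where "s \<in> {0..2*pi}" "w = of_real R * exp (\<i> * of_real s)"
  using assms Arg2pi[of w] that[of "Arg2pi w"] by (auto simp: is_Arg_def)

text \<open>The angles \<open>\<phi> j\<close> are absorbed into the functions \<open>G j\<close>,
  so the single point \<open>w\<close> of the outer circle found by the maximum principle rotates
  all sample points by the same \<open>s\<close>.\<close>

lemma sum_norm_powr_circle_mono:
  fixes \<phi> :: "'i \<Rightarrow> real"
  assumes f: "f holomorphic_on UNIV" and J: "finite J" and p: "p > 0" and r: "0 \<le> r" "r \<le> R"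
  shows "\<exists>s\<in>{0..2*pi}. (\<Sum>j\<in>J. cmod (f (of_real r * exp (\<i> * of_real (\<phi> j)))) powr p)
    \<le> (\<Sum>j\<in>J. cmod (f (of_real R * exp (\<i> * of_real (s + \<phi> j)))) powr p)"
proof -
  define G where "G j z = f (z * exp (\<i> * of_real (\<phi> j)))" for j z
  have hol: "G j holomorphic_on A" for j A
    unfolding G_def
    by (rule holomorphic_on_compose[OF _ holomorphic_on_subset[OF f], unfolded o_def])
       (auto intro!: holomorphic_intros)
  obtain w where w: "w \<in> frontier (cball 0 R)"
    "(\<Sum>j\<in>J. cmod (G j (of_real r)) powr p) \<le> (\<Sum>j\<in>J. cmod (G j w) powr p)"
    by (rule sum_norm_powr_le_frontier[of "cball 0 R" "of_real r" J p G])
       (use r J p hol in \<open>auto intro: holomorphic_on_imp_continuous_on\<close>)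
  then have "cmod w = R" using r by (cases "R = 0") (auto simp: frontier_def)
  then obtain s where s: "s \<in> {0..2*pi}" "w = of_real R * exp (\<i> * of_real s)"
    by (rule exists_circle_angle)
  have "G j w = f (of_real R * exp (\<i> * of_real (s + \<phi> j)))" for j
    by (simp add: G_def s exp_add distrib_left mult.assoc)
  then show ?thesis using w(2) s(1) by (auto simp: G_def)
qed

text \<open>Maximum principle on a closed annulus for products of \<open>f\<close> with its
  reflection in the circle of radius \<open>sqrt (a * b)\<close>. The exponent \<open>p/2\<close>
  compensates the square on the middle circle; on either boundary circle the two factors are values
  at the radii \<open>a\<close> and \<open>b\<close> with one common angle.\<close>

lemma sum_norm_powr_circle_geometric:
  fixes \<phi> :: "'i \<Rightarrow> real"
  assumes f: "f holomorphic_on UNIV" and J: "finite J" and p: "p > 0" and ab: "0 < a" "a \<le> b"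
  shows "\<exists>s\<in>{0..2*pi}. (\<Sum>j\<in>J. cmod (f (of_real (sqrt (a * b)) * exp (\<i> * of_real (\<phi> j)))) powr p)
    \<le> (\<Sum>j\<in>J. cmod (f (of_real a * exp (\<i> * of_real (s + \<phi> j)))) powr (p/2) *
               cmod (f (of_real b * exp (\<i> * of_real (s + \<phi> j)))) powr (p/2))"
proof -
  define r where "r = sqrt (a * b)"
  have r: "r > 0" "r\<^sup>2 = a * b" using ab by (auto simp: r_def)
  have "a \<le> r" "r \<le> b"
    using ab r by (auto intro!: real_le_rsqrt real_le_lsqrt simp: r_def power2_eq_square)
  define E where "E j = exp (\<i> * of_real (\<phi> j))" for j
  \<comment> \<open>\<open>\<bar>G j\<bar>\<close> is \<open>\<bar>f\<bar>\<^sup>2\<close> on the middle circle, and \<open>z \<mapsto> ab / cnj z\<close> exchanges the boundary circles\<close>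
  define G where "G j z = f (z * E j) * cnj (f (cnj (of_real (a * b) * cnj (E j) / z)))" for j z
  define K where "K = cball 0 b - ball (0::complex) a"
  have K: "compact K" "0 \<notin> K" using ab by (auto simp: K_def compact_diff)
  have hol: "G j holomorphic_on K" for j
  proof -
    have 1: "(\<lambda>z. f (z * E j)) holomorphic_on K"
      by (rule holomorphic_on_compose[OF _ holomorphic_on_subset[OF f], unfolded o_def])
         (auto intro!: holomorphic_intros)
    \<comment> \<open>Conjugating both inside and outside preserves holomorphy, which makes the
      reflected factor of \<open>G j\<close> holomorphic away from \<open>0\<close>.\<close>
    have 2: "(cnj \<circ> f \<circ> cnj) holomorphic_on UNIV"
      using f by (intro holomorphic_on_compose_cnj_cnj) (auto intro: holomorphic_on_subset)
    have "(\<lambda>z. (cnj \<circ> f \<circ> cnj) (of_real (a * b) * cnj (E j) / z)) holomorphic_on K"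
    proof -
      have "(\<lambda>z. of_real (a * b) * cnj (E j) / z) holomorphic_on K"
        using K(2) by (auto intro!: holomorphic_intros)
      from holomorphic_on_compose_gen[OF this 2] show ?thesis by (simp add: o_def)
    qed
    with 1 have "(\<lambda>z. f (z * E j) * (cnj \<circ> f \<circ> cnj) (of_real (a * b) * cnj (E j) / z)) holomorphic_on K"
      by (rule holomorphic_on_mult)
    then show ?thesis
      by (simp add: G_def[abs_def] o_def)
  qed
  obtain w where w: "w \<in> frontier K"
    "(\<Sum>j\<in>J. cmod (G j (of_real r)) powr (p/2)) \<le> (\<Sum>j\<in>J. cmod (G j w) powr (p/2))"
  proof (rule sum_norm_powr_le_frontier[of K "of_real r" J "p/2" G])
    show "of_real r \<in> K" using \<open>a \<le> r\<close> \<open>r \<le> b\<close> r(1) by (simp add: K_def)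
    show "G j holomorphic_on interior K" for j
      using hol interior_subset by (rule holomorphic_on_subset)
  qed (use K J p hol in \<open>auto intro: holomorphic_on_imp_continuous_on\<close>)
  have "w \<in> K" using w K(1) by (auto simp: frontier_def compact_imp_closed)
  \<comment> \<open>Points of \<open>K\<close> off both boundary circles are interior, so the
    frontier point \<open>w\<close> has modulus \<open>a\<close> or \<open>b\<close>.\<close>
  have "ball 0 b - cball 0 a \<subseteq> interior K"
    by (rule interior_maximal) (auto simp: K_def open_Diff)
  then have "cmod w = a \<or> cmod w = b"
    using w(1) \<open>w \<in> K\<close> by (force simp: frontier_def K_def)
  then obtain c where c: "c = a \<or> c = b" "cmod w = c" by blast
  from c(2) obtain s where s: "s \<in> {0..2*pi}" "w = of_real c * exp (\<i> * of_real s)"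
    by (rule exists_circle_angle)
  have "cmod (G j w) = cmod (f (of_real a * exp (\<i> * of_real (s + \<phi> j)))) *
               cmod (f (of_real b * exp (\<i> * of_real (s + \<phi> j))))" for j
  proof -
    have 1: "w * E j = of_real c * exp (\<i> * of_real (s + \<phi> j))"
      by (simp add: s E_def exp_add distrib_left mult.assoc)
    have 2: "cnj (of_real (a * b) * cnj (E j) / w) = of_real (a * b / c) * exp (\<i> * of_real (s + \<phi> j))"
      by (simp add: s E_def exp_add distrib_left exp_cnj exp_minus divide_simps)
    show ?thesis
      unfolding G_def 1 2 using c ab by (auto simp: norm_mult)
  qed
  moreover have "cmod (G j (of_real r)) = (cmod (f (of_real r * E j)))\<^sup>2" for j
  proof -
    have "cnj (of_real (a * b) * cnj (E j) / of_real r) = of_real r * E j"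
      using r(1) unfolding r(2)[symmetric] by (simp add: power2_eq_square)
    then show ?thesis by (simp add: G_def norm_mult power2_eq_square)
  qed
  moreover have "(x\<^sup>2) powr (p/2) = x powr p" if "x \<ge> 0" for x :: real
    using that powr_powr[of x 2 "p/2"] by (cases "x = 0") auto
  ultimately have "(\<Sum>j\<in>J. cmod (f (of_real r * E j)) powr p)
    \<le> (\<Sum>j\<in>J. cmod (f (of_real a * exp (\<i> * of_real (s + \<phi> j)))) powr (p/2) *
               cmod (f (of_real b * exp (\<i> * of_real (s + \<phi> j)))) powr (p/2))"
    using w(2) by (simp add: powr_mult)
  then show ?thesis using s(1) by (auto simp: r_def E_def)
qed

section \<open>Circle integrals: monotonicity and convexity in the radius\<close>

lemma continuous_on_norm_powr_circle:
  assumes f: "f holomorphic_on UNIV" and p: "p > 0"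
  shows "continuous_on A (\<lambda>\<theta>. cmod (f (of_real r * exp (\<i> * of_real \<theta>))) powr p)"
proof -
  have "continuous_on UNIV f" using f by (rule holomorphic_on_imp_continuous_on)
  then have "continuous_on A (\<lambda>\<theta>. f (of_real r * exp (\<i> * of_real \<theta>)))"
    by (rule continuous_on_compose2) (auto intro!: continuous_intros)
  then show ?thesis using p by (intro continuous_on_powr' continuous_intros) auto
qed

lemma exp_circle_periodic: "exp (\<i> * of_real (x + 2 * pi)) = exp (\<i> * of_real x)"
  by (simp add: complex_eq_iff del: of_real_add flip: cis_conv_exp)

lemma integral_norm_powr_circle_nonneg:
  assumes f: "f holomorphic_on UNIV" and p: "p > 0"
  shows "0 \<le> integral {0..2*pi} (\<lambda>\<theta>. cmod (f (of_real r * exp (\<i> * of_real \<theta>))) powr p)"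
  by (rule integral_nonneg[OF integrable_continuous_real[OF continuous_on_norm_powr_circle[OF f p]]]) simp

lemma integral_norm_powr_circle_mono:
  assumes f: "f holomorphic_on UNIV" and p: "p > 0" and r: "0 \<le> r" "r \<le> R"
  shows "integral {0..2*pi} (\<lambda>\<theta>. cmod (f (of_real r * exp (\<i> * of_real \<theta>))) powr p)
    \<le> integral {0..2*pi} (\<lambda>\<theta>. cmod (f (of_real R * exp (\<i> * of_real \<theta>))) powr p)"
proof (rule integral_le_of_equidistant_sums_le)
  fix n :: nat
  show "\<exists>s\<in>{0..2*pi}.
      (\<Sum>j<n. cmod (f (of_real r * exp (\<i> * of_real (real j * (2 * pi / n))))) powr p)
      \<le> (\<Sum>j<n. cmod (f (of_real R * exp (\<i> * of_real (s + real j * (2 * pi / n))))) powr p)"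
    using assms by (intro sum_norm_powr_circle_mono) auto
qed (use f p in \<open>auto intro: continuous_on_norm_powr_circle simp del: of_real_add simp: exp_circle_periodic\<close>)

text \<open>The integral of the square of \<open>g x - t * h x\<close> is a quadratic polynomial in
  \<open>t\<close> that is nowhere negative; the claim is its value at the minimum
  \<open>t = Y / Z\<close>.\<close>

lemma integral_Cauchy_Schwarz:
  fixes g h :: "real \<Rightarrow> real"
  assumes g: "continuous_on {a..b} g" and h: "continuous_on {a..b} h"
  shows "(integral {a..b} (\<lambda>x. g x * h x))\<^sup>2
    \<le> integral {a..b} (\<lambda>x. (g x)\<^sup>2) * integral {a..b} (\<lambda>x. (h x)\<^sup>2)"
proof -
  define X Y Z where "X = integral {a..b} (\<lambda>x. (g x)\<^sup>2)"
    and "Y = integral {a..b} (\<lambda>x. g x * h x)" and "Z = integral {a..b} (\<lambda>x. (h x)\<^sup>2)"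
  have quad: "0 \<le> X - 2 * t * Y + t\<^sup>2 * Z" for t
  proof -
    have "((\<lambda>x. (g x)\<^sup>2 - 2 * t * (g x * h x) + t\<^sup>2 * (h x)\<^sup>2) has_integral X - 2 * t * Y + t\<^sup>2 * Z) {a..b}"
      unfolding X_def Y_def Z_def
      by (intro has_integral_add has_integral_diff has_integral_mult_right integrable_integral
        integrable_continuous_real continuous_intros g h)
    moreover have "0 \<le> (g x)\<^sup>2 - 2 * t * (g x * h x) + t\<^sup>2 * (h x)\<^sup>2" for x
      using zero_le_power2[of "g x - t * h x"] by (simp add: power2_eq_square algebra_simps)
    ultimately show ?thesis by (rule has_integral_nonneg)
  qed
  have "Z \<ge> 0" unfolding Z_def by (rule integral_nonneg) (auto intro!: integrable_continuous_real continuous_intros h)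
  have "Y\<^sup>2 \<le> X * Z"
  proof (cases "Z = 0")
    case True
    \<comment> \<open>With \<open>Z = 0\<close> the polynomial is linear in \<open>t\<close>; if
      \<open>Y \<noteq> 0\<close>, this \<open>t\<close> would give it the value
      \<open>-1\<close>.\<close>
    then have "Y = 0" using quad[of "(X + 1) / (2 * Y)"] by (auto split: if_splits)
    then show ?thesis using True by simp
  next
    case False
    then have "0 \<le> (X - 2 * (Y / Z) * Y + (Y / Z)\<^sup>2 * Z) * Z"
      using quad \<open>Z \<ge> 0\<close> by (intro mult_nonneg_nonneg)
    also have "\<dots> = X * Z - Y\<^sup>2" using False by (simp add: field_simps power2_eq_square)
    finally show ?thesis by simp
  qed
  then show ?thesis by (simp add: X_def Y_def Z_def)
qed

text \<open>The sample sums yield in the limit the integral of the product of half powers at the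
  radii \<open>a\<close> and \<open>b\<close>, and Cauchy-Schwarz separates the two radii.\<close>

lemma integral_norm_powr_circle_geometric:
  assumes f: "f holomorphic_on UNIV" and p: "p > 0" and ab: "0 < a" "a \<le> b"
  defines "I \<equiv> \<lambda>r. integral {0..2*pi} (\<lambda>\<theta>. cmod (f (of_real r * exp (\<i> * of_real \<theta>))) powr p)"
  shows "(I (sqrt (a * b)))\<^sup>2 \<le> I a * I b"
proof -
  define w where "w r \<theta> = cmod (f (of_real r * exp (\<i> * of_real \<theta>))) powr (p/2)" for r \<theta>
  have cont: "continuous_on A (w r)" for r A
    unfolding w_def using f p by (intro continuous_on_norm_powr_circle) auto
  have sq: "(w r \<theta>)\<^sup>2 = cmod (f (of_real r * exp (\<i> * of_real \<theta>))) powr p" for r \<theta>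
    by (simp add: w_def power2_eq_square flip: powr_add)
  have "I (sqrt (a * b)) \<le> integral {0..2*pi} (\<lambda>\<theta>. w a \<theta> * w b \<theta>)"
    unfolding I_def
  proof (rule integral_le_of_equidistant_sums_le)
    fix n :: nat
    show "\<exists>s\<in>{0..2*pi}.
      (\<Sum>j<n. cmod (f (of_real (sqrt (a * b)) * exp (\<i> * of_real (real j * (2 * pi / n))))) powr p)
      \<le> (\<Sum>j<n. w a (s + real j * (2 * pi / n)) * w b (s + real j * (2 * pi / n)))"
      unfolding w_def using assms by (intro sum_norm_powr_circle_geometric) auto
    show "w a (x + 2 * pi) * w b (x + 2 * pi) = w a x * w b x" for x
      by (simp only: w_def exp_circle_periodic)
  qed (auto intro!: continuous_on_norm_powr_circle[OF f p] continuous_on_mult cont)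
  moreover have "0 \<le> I (sqrt (a * b))"
    unfolding I_def by (rule integral_norm_powr_circle_nonneg[OF f p])
  ultimately have "(I (sqrt (a * b)))\<^sup>2 \<le> (integral {0..2*pi} (\<lambda>\<theta>. w a \<theta> * w b \<theta>))\<^sup>2"
    by (intro power_mono)
  also have "\<dots> \<le> integral {0..2*pi} (\<lambda>x. (w a x)\<^sup>2) * integral {0..2*pi} (\<lambda>x. (w b x)\<^sup>2)"
    by (intro integral_Cauchy_Schwarz cont)
  finally show ?thesis by (simp add: sq I_def)
qed

section \<open>Integral means for all exponents in (0, infinity]\<close>

lemma norm_le_integral_mean_infinity:
  assumes f: "f holomorphic_on UNIV"
  shows "cmod (f (of_real r * exp (\<i> * of_real s))) \<le> integral_mean \<infinity> f r"
proof -
  let ?g = "\<lambda>\<theta>. cmod (f (of_real r * exp (\<i> * of_real \<theta>)))"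
  obtain t where t: "t \<in> {0..2*pi}" "exp (\<i> * of_real s) = of_real 1 * exp (\<i> * of_real t)"
    using exists_circle_angle[of "exp (\<i> * of_real s)" 1] by auto
  \<comment> \<open>A real \<open>SUP\<close> dominates its members only when they are bounded
    above; continuity on a compact interval supplies this.\<close>
  have "continuous_on {0..2*pi} ?g"
    using continuous_on_norm_powr_circle[OF f, of 1] by simp
  then have "compact (?g ` {0..2*pi})"
    by (rule compact_continuous_image) auto
  then have "bdd_above (?g ` {0..2*pi})"
    by (intro bounded_imp_bdd_above compact_imp_bounded)
  then have "?g t \<le> (SUP \<theta>\<in>{0..2*pi}. ?g \<theta>)"
    by (intro cSUP_upper t)
  then show ?thesis
    by (simp add: integral_mean_def t)
qed

lemma integral_mean_infinity_le:
  assumes "\<And>\<theta>. cmod (f (of_real r * exp (\<i> * of_real \<theta>))) \<le> B"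
  shows "integral_mean \<infinity> f r \<le> B"
  using assms by (auto simp: integral_mean_def intro!: cSUP_least)

lemma integral_mean_nonneg:
  assumes "f holomorphic_on UNIV"
  shows "0 \<le> integral_mean p f r"
proof (cases "p = \<infinity>")
  case True
  then show ?thesis
    using order_trans[OF norm_ge_zero norm_le_integral_mean_infinity[OF assms]] by blast
qed (simp add: integral_mean_def)

lemma integral_mean_mono:
  assumes f: "f holomorphic_on UNIV" and p: "p > 0" and r: "0 \<le> r" "r \<le> R"
  shows "integral_mean p f r \<le> integral_mean p f R"
proof (cases "p = \<infinity>")
  case True
  have "cmod (f (of_real r * exp (\<i> * of_real \<theta>))) \<le> integral_mean \<infinity> f R" for \<theta>
  proof -
    \<comment> \<open>A singleton index set with exponent \<open>1\<close> reduces the sum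
      inequality to a pointwise bound at a rotated angle.\<close>
    obtain s where "cmod (f (of_real r * exp (\<i> * of_real \<theta>)))
        \<le> cmod (f (of_real R * exp (\<i> * of_real (s + \<theta>))))"
      using sum_norm_powr_circle_mono[OF f, of "{()}" 1 r R "\<lambda>_. \<theta>"] r by auto
    also note norm_le_integral_mean_infinity[OF f]
    finally show ?thesis .
  qed
  then show ?thesis
    unfolding True by (rule integral_mean_infinity_le)
next
  case False
  then have p': "enn2real p > 0" using p by (simp add: enn2real_positive_iff top.not_eq_extremum)
  show ?thesis
    using False p' integral_norm_powr_circle_mono[OF f p' r] integral_norm_powr_circle_nonneg[OF f p']
    by (auto simp: integral_mean_def intro!: powr_mono2 divide_right_mono)
qed

lemma integral_mean_geometric:
  assumes f: "f holomorphic_on UNIV" and p: "p > 0" and ab: "0 < a" "a \<le> b"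
  shows "(integral_mean p f (sqrt (a * b)))\<^sup>2 \<le> integral_mean p f a * integral_mean p f b"
proof (cases "p = \<infinity>")
  case True
  let ?B = "integral_mean \<infinity> f a * integral_mean \<infinity> f b"
  have "cmod (f (of_real (sqrt (a * b)) * exp (\<i> * of_real \<theta>))) \<le> sqrt ?B" for \<theta>
  proof (rule real_le_rsqrt)
    \<comment> \<open>A singleton index set with exponent \<open>2\<close>, so that the half powers
      on the right have exponent \<open>1\<close>.\<close>
    obtain s where "(cmod (f (of_real (sqrt (a * b)) * exp (\<i> * of_real \<theta>))))\<^sup>2
      \<le> cmod (f (of_real a * exp (\<i> * of_real (s + \<theta>)))) * cmod (f (of_real b * exp (\<i> * of_real (s + \<theta>))))"
      using sum_norm_powr_circle_geometric[OF f, of "{()}" 2 a b "\<lambda>_. \<theta>"] ab by auto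
    also have "\<dots> \<le> ?B"
      by (intro mult_mono norm_le_integral_mean_infinity integral_mean_nonneg f norm_ge_zero)
    finally show "(cmod (f (of_real (sqrt (a * b)) * exp (\<i> * of_real \<theta>))))\<^sup>2 \<le> ?B" .
  qed
  then have "integral_mean \<infinity> f (sqrt (a * b)) \<le> sqrt ?B"
    by (rule integral_mean_infinity_le)
  then have "(integral_mean \<infinity> f (sqrt (a * b)))\<^sup>2 \<le> (sqrt ?B)\<^sup>2"
    by (intro power_mono integral_mean_nonneg f)
  then show ?thesis
    using integral_mean_nonneg[OF f] by (simp add: True)
next
  case False
  define P where "P = enn2real p"
  have P: "P > 0" using p False by (simp add: P_def enn2real_positive_iff top.not_eq_extremum)
  define I where "I r = 1 / (2*pi) *
    integral {0..2*pi} (\<lambda>\<theta>. cmod (f (of_real r * exp (\<i> * of_real \<theta>))) powr P)" for r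
  have I: "0 \<le> I r" for r
    using integral_norm_powr_circle_nonneg[OF f P] by (simp add: I_def)
  have M: "integral_mean p f r = I r powr (1 / P)" for r
    using False by (simp add: integral_mean_def I_def P_def)
  have "(I (sqrt (a * b)))\<^sup>2 \<le> I a * I b"
    using integral_norm_powr_circle_geometric[OF f P ab]
    by (simp add: I_def power2_eq_square divide_right_mono)
  then have "((I (sqrt (a * b)))\<^sup>2) powr (1 / P) \<le> (I a * I b) powr (1 / P)"
    using P by (intro powr_mono2) auto
  then show ?thesis
    using I by (simp add: M powr_mult power2_eq_square)
qed

subsection \<open>The pointwise bound\<close>

text \<open>Passing from the product to the sum by AM-GM leaves terms linear in \<open>h\<close>,
  which can be integrated over \<open>u\<close> separately.\<close>

lemma gaussian_mean_le_average:
  fixes \<alpha> Q r u :: real and p :: ennreal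
  assumes f: "f holomorphic_on UNIV" and p: "p > 0" and \<alpha>: "\<alpha> > 0" and Q: "Q > 0"
    and r: "r \<ge> 0" and u: "u \<in> {0..1/2}"
  defines "R \<equiv> sqrt (r\<^sup>2 + 1)"
    and "h \<equiv> \<lambda>s. integral_mean p f s powr Q * exp (- (\<alpha> * Q / 2) * s\<^sup>2)"
  shows "h r \<le> exp (\<alpha> * Q) / 2 * (h (R - u) + h (R + u))"
proof -
  define m where "m = integral_mean p f"
  have m: "0 \<le> m s" for s using integral_mean_nonneg[OF f] by (simp add: m_def)
  \<comment> \<open>\<open>R\<close> is chosen so that the geometric mean of \<open>R - u\<close> and \<open>R + u\<close> is at least \<open>r\<close>\<close>
  have R: "R \<ge> 1" "R\<^sup>2 = r\<^sup>2 + 1" by (auto simp: R_def)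
  have u2: "u\<^sup>2 \<le> 1" using u power_le_one[of u 2] by auto
  have prod: "(R - u) * (R + u) = r\<^sup>2 + 1 - u\<^sup>2"
    using R(2) by (simp add: power2_eq_square algebra_simps)
  have "r \<le> sqrt ((R - u) * (R + u))"
    unfolding prod using u2 by (intro real_le_rsqrt) auto
  then have "(m r)\<^sup>2 \<le> (m (sqrt ((R - u) * (R + u))))\<^sup>2"
    using m r integral_mean_mono[OF f p] by (intro power_mono) (auto simp: m_def)
  \<comment> \<open>\<open>u \<le> 1/2\<close> and \<open>R \<ge> 1\<close> keep the inner radius
    positive, as the convexity requires.\<close>
  also have "\<dots> \<le> m (R - u) * m (R + u)"
    unfolding m_def using u R by (intro integral_mean_geometric f p) auto
  finally have "((m r)\<^sup>2) powr Q \<le> (m (R - u) * m (R + u)) powr Q"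
    using Q by (intro powr_mono2) auto
  then have mQ: "(m r powr Q)\<^sup>2 \<le> m (R - u) powr Q * m (R + u) powr Q"
    using m by (simp add: power2_eq_square powr_mult)
  have "(h r)\<^sup>2 = (m r powr Q)\<^sup>2 * exp (- (\<alpha> * Q) * r\<^sup>2)"
    by (simp add: h_def m_def power_mult_distrib flip: exp_of_nat_mult)
  also have "\<dots> \<le> (m (R - u) powr Q * m (R + u) powr Q) *
      exp (2 * (\<alpha> * Q) + (- (\<alpha> * Q / 2) * (R - u)\<^sup>2) + (- (\<alpha> * Q / 2) * (R + u)\<^sup>2))"
  proof (intro mult_mono mQ)
    \<comment> \<open>Since \<open>R\<^sup>2 = r\<^sup>2 + 1\<close> and
      \<open>u\<^sup>2 \<le> 1\<close>, the weights at \<open>R - u\<close> and \<open>R + u\<close>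
      together lose at most \<open>exp (2 * (\<alpha> * Q))\<close> against the squared weight at
      \<open>r\<close>; the square root leaves \<open>exp (\<alpha> * Q)\<close>.\<close>
    have "\<alpha> * Q * (R\<^sup>2 + u\<^sup>2) \<le> \<alpha> * Q * (r\<^sup>2 + 2)"
      using u2 R \<alpha> Q by (intro mult_left_mono) auto
    then show "exp (- (\<alpha> * Q) * r\<^sup>2)
      \<le> exp (2 * (\<alpha> * Q) + (- (\<alpha> * Q / 2) * (R - u)\<^sup>2) + (- (\<alpha> * Q / 2) * (R + u)\<^sup>2))"
      by (simp add: power2_sum power2_diff algebra_simps)
  qed auto
  also have "\<dots> = (exp (\<alpha> * Q))\<^sup>2 * (h (R - u) * h (R + u))"
    unfolding exp_add by (simp add: h_def m_def flip: exp_of_nat_mult)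
  finally have "h r \<le> sqrt ((exp (\<alpha> * Q))\<^sup>2 * (h (R - u) * h (R + u)))"
    by (rule real_le_rsqrt)
  also have "\<dots> = exp (\<alpha> * Q) * sqrt (h (R - u) * h (R + u))"
    by (simp add: real_sqrt_mult)
  also have "\<dots> \<le> exp (\<alpha> * Q) * ((h (R - u) + h (R + u)) / 2)"
    using arith_geo_mean_sqrt[of "h (R - u)" "h (R + u)"]
    by (intro mult_left_mono) (auto simp: h_def)
  finally show ?thesis by simp
qed

text \<open>Averaging over \<open>u \<in> {0..1/2}\<close> involves only radii
  \<open>s \<ge> R - 1/2 \<ge> R/2\<close>, where \<open>1 \<le> 2 * s / R\<close> supplies the
  factor \<open>s\<close> of the measure. This gives \<open>4 / R\<close>, and
  \<open>R \<ge> (1 + r) / 2\<close> turns it into \<open>8 / (1 + r)\<close>.\<close>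

lemma gaussian_mean_le_integral:
  fixes \<alpha> Q r :: real and p :: ennreal
  assumes f: "f holomorphic_on UNIV" and p: "p > 0" and \<alpha>: "\<alpha> > 0" and Q: "Q > 0" and r: "r \<ge> 0"
  defines "I \<equiv> \<integral>\<^sup>+ s\<in>{0..}. ennreal (integral_mean p f s powr Q * (\<alpha> * Q) *
      exp (- (\<alpha> * Q / 2) * s\<^sup>2) * s) \<partial>lborel"
  assumes fin: "I < \<infinity>"
  shows "integral_mean p f r powr Q * exp (- (\<alpha> * Q / 2) * r\<^sup>2)
    \<le> 8 * exp (\<alpha> * Q) / (\<alpha> * Q) / (1 + r) * enn2real I"
proof -
  define h where "h s = integral_mean p f s powr Q * exp (- (\<alpha> * Q / 2) * s\<^sup>2)" for s
  define R where "R = sqrt (r\<^sup>2 + 1)"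
  have R: "R \<ge> 1" by (simp add: R_def)
  have Rr: "(1 + r) / 2 \<le> R"
  proof -
    have "((1 + r) / 2)\<^sup>2 \<le> r\<^sup>2 + 1"
    proof -
      have "r\<^sup>2 + 1 - ((1 + r) / 2)\<^sup>2 = (r - 1)\<^sup>2 / 4 + (r\<^sup>2 + 1) / 2"
        by (simp add: power_divide power2_sum power2_diff field_simps)
      also have "\<dots> \<ge> 0" by simp
      finally show ?thesis by simp
    qed
    then show ?thesis unfolding R_def by (rule real_le_rsqrt)
  qed
  \<comment> \<open>the truncation \<open>max 0 s\<close> makes the mean monotone on the whole line, hence measurable\<close>
  define H where "H s = ennreal (integral_mean p f (max 0 s) powr Q * exp (- (\<alpha> * Q / 2) * s\<^sup>2)) *
    indicator {R/2..} s" for s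
  have "mono (\<lambda>s. integral_mean p f (max 0 s))"
    by (intro monoI integral_mean_mono f p) auto
  then have [measurable]: "(\<lambda>s. integral_mean p f (max 0 s)) \<in> borel_measurable borel"
    by (rule borel_measurable_mono)
  have H [measurable]: "H \<in> borel_measurable borel"
    unfolding H_def by measurable
  have H_eq: "H s = ennreal (h s)" if "R/2 \<le> s" for s
    using that R by (simp add: H_def h_def max_def)
  have H_le: "H s \<le> ennreal (2 / (R * (\<alpha> * Q))) * (ennreal (integral_mean p f s powr Q * (\<alpha> * Q) *
      exp (- (\<alpha> * Q / 2) * s\<^sup>2) * s) * indicator {0..} s)" for s
  proof (cases "R/2 \<le> s")
    case True
    have "h s * 1 \<le> h s * (2 * s / R)"
      using True R by (intro mult_left_mono) (auto simp: h_def field_simps)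
    also have "\<dots> = 2 / (R * (\<alpha> * Q)) * (integral_mean p f s powr Q * (\<alpha> * Q) *
      exp (- (\<alpha> * Q / 2) * s\<^sup>2) * s)"
      using \<alpha> Q R by (simp add: h_def)
    finally show ?thesis
      using True R \<alpha> Q by (simp add: H_eq ennreal_leI flip: ennreal_mult)
  qed (simp add: H_def)
  have int_H: "(\<integral>\<^sup>+ s. H s \<partial>lborel) \<le> ennreal (2 / (R * (\<alpha> * Q))) * I"
  proof -
    \<comment> \<open>Here \<open>max 0 s\<close> provides the measurability needed to pull out the
      constant; the indicator makes it harmless.\<close>
    have "(\<integral>\<^sup>+ s. H s \<partial>lborel) \<le> (\<integral>\<^sup>+ s. ennreal (2 / (R * (\<alpha> * Q))) *
        (ennreal (integral_mean p f (max 0 s) powr Q * (\<alpha> * Q) *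
          exp (- (\<alpha> * Q / 2) * s\<^sup>2) * s) * indicator {0..} s) \<partial>lborel)"
    proof (rule nn_integral_mono)
      show "H s \<le> ennreal (2 / (R * (\<alpha> * Q))) *
        (ennreal (integral_mean p f (max 0 s) powr Q * (\<alpha> * Q) *
          exp (- (\<alpha> * Q / 2) * s\<^sup>2) * s) * indicator {0..} s)" for s
        using H_le[of s] by (cases "s \<ge> 0") (auto simp: max_def)
    qed
    also have "\<dots> = ennreal (2 / (R * (\<alpha> * Q))) * (\<integral>\<^sup>+ s. ennreal (integral_mean p f (max 0 s) powr Q * (\<alpha> * Q) *
          exp (- (\<alpha> * Q / 2) * s\<^sup>2) * s) * indicator {0..} s \<partial>lborel)"
      by (rule nn_integral_cmult) measurable
    also have "(\<integral>\<^sup>+ s. ennreal (integral_mean p f (max 0 s) powr Q * (\<alpha> * Q) *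
          exp (- (\<alpha> * Q / 2) * s\<^sup>2) * s) * indicator {0..} s \<partial>lborel) = I"
      unfolding I_def by (rule nn_integral_cong) (auto simp: indicator_def max_def)
    finally show ?thesis .
  qed
  have hr: "h r \<ge> 0" by (simp add: h_def)
  \<comment> \<open>A constant integrated over an interval of length \<open>1/2\<close>, which
    starts the averaging over \<open>u\<close>.\<close>
  have "ennreal (h r / 2) = (\<integral>\<^sup>+ u. ennreal (h r) * indicator {0..1/2 :: real} u \<partial>lborel)"
    using ennreal_divide_numeral[OF hr, of "Num.Bit0 Num.One"]
    by (subst nn_integral_cmult_indicator) (simp_all add: divide_ennreal_def)
  \<comment> \<open>The left integrand vanishes off \<open>{0..1/2}\<close>, so the right one may
    extend over the whole line; the factors \<open>-1\<close> and \<open>1\<close> match the affine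
    substitutions below.\<close>
  also have "\<dots> \<le> (\<integral>\<^sup>+ u. ennreal (exp (\<alpha> * Q) / 2) * (H (R + -1 * u) + H (R + 1 * u)) \<partial>lborel)"
  proof (rule nn_integral_mono)
    fix u :: real
    show "ennreal (h r) * indicator {0..1/2} u
      \<le> ennreal (exp (\<alpha> * Q) / 2) * (H (R + -1 * u) + H (R + 1 * u))"
    proof (cases "u \<in> {0..1/2}")
      case True
      have "h r \<le> exp (\<alpha> * Q) / 2 * (h (R - u) + h (R + u))"
        using gaussian_mean_le_average[OF f p \<alpha> Q r True] by (simp add: h_def R_def)
      then have "ennreal (h r) \<le> ennreal (exp (\<alpha> * Q) / 2) * (ennreal (h (R - u)) + ennreal (h (R + u)))"
        by (simp add: h_def ennreal_leI flip: ennreal_mult ennreal_plus)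
      then show ?thesis
        using True R by (simp add: H_eq)
    qed simp
  qed
  also have "\<dots> = ennreal (exp (\<alpha> * Q) / 2) *
      ((\<integral>\<^sup>+ u. H (R + -1 * u) \<partial>lborel) + (\<integral>\<^sup>+ u. H (R + 1 * u) \<partial>lborel))"
    by (subst nn_integral_cmult) (auto simp: nn_integral_add)
  also have "(\<integral>\<^sup>+ u. H (R + -1 * u) \<partial>lborel) = (\<integral>\<^sup>+ s. H s \<partial>lborel)"
    using nn_integral_real_affine[OF H, of "-1" R] by simp
  also have "(\<integral>\<^sup>+ u. H (R + 1 * u) \<partial>lborel) = (\<integral>\<^sup>+ s. H s \<partial>lborel)"
    using nn_integral_real_affine[OF H, of 1 R] by simp
  also have "ennreal (exp (\<alpha> * Q) / 2) * ((\<integral>\<^sup>+ s. H s \<partial>lborel) + (\<integral>\<^sup>+ s. H s \<partial>lborel))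
    \<le> ennreal (exp (\<alpha> * Q) / 2) * (ennreal (2 / (R * (\<alpha> * Q))) * I + ennreal (2 / (R * (\<alpha> * Q))) * I)"
    by (intro mult_left_mono add_mono int_H) auto
  also have "\<dots> = ennreal (exp (\<alpha> * Q) / 2 * (4 / (R * (\<alpha> * Q)) * enn2real I))"
  proof -
    obtain i where i: "i \<ge> 0" "I = ennreal i" using fin by (cases I) auto
    then show ?thesis
      using \<alpha> Q R by (simp add: field_simps flip: ennreal_mult ennreal_plus)
  qed
  finally have "h r / 2 \<le> exp (\<alpha> * Q) / 2 * (4 / (R * (\<alpha> * Q)) * enn2real I)"
    using \<alpha> Q R by (subst (asm) ennreal_le_iff) auto
  then have "h r \<le> 4 * exp (\<alpha> * Q) / (\<alpha> * Q) * enn2real I / R"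
    by (simp add: mult_ac)
  also have "\<dots> \<le> 4 * exp (\<alpha> * Q) / (\<alpha> * Q) * enn2real I / ((1 + r) / 2)"
    using Rr r \<alpha> Q by (intro divide_left_mono) (auto intro!: mult_pos_pos)
  finally show ?thesis by (simp add: h_def mult_ac)
qed

section \<open>From weighted means to the Fock norm\<close>

lemma integral_mean_le_fock_norm_infinity:
  fixes r :: real
  assumes f: "f holomorphic_on UNIV" and fin: "fock_norm \<alpha> p \<infinity> f < \<infinity>" and r: "r \<ge> 0"
  shows "integral_mean p f r \<le> exp (\<alpha> / 2 * r\<^sup>2) * enn2real (fock_norm \<alpha> p \<infinity> f)"
proof -
  have "ennreal (integral_mean p f r * exp (- (\<alpha> / 2) * r\<^sup>2)) \<le> fock_norm \<alpha> p \<infinity> f"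
    unfolding fock_norm_def using r by (auto intro!: SUP_upper2[of r])
  then have "integral_mean p f r * exp (- (\<alpha> / 2) * r\<^sup>2) \<le> enn2real (fock_norm \<alpha> p \<infinity> f)"
    using fin by (cases "fock_norm \<alpha> p \<infinity> f") auto
  then have "integral_mean p f r * exp (- (\<alpha> / 2) * r\<^sup>2) * exp (\<alpha> / 2 * r\<^sup>2)
    \<le> enn2real (fock_norm \<alpha> p \<infinity> f) * exp (\<alpha> / 2 * r\<^sup>2)"
    by (intro mult_right_mono) auto
  then show ?thesis
    by (simp add: exp_minus mult_ac)
qed

text \<open>The \<open>Q\<close>-th root of the integral bound. The resulting constant contains
  neither \<open>p\<close> nor \<open>f\<close>, as the uniformity of the theorem demands.\<close>

lemma integral_mean_le_fock_norm_finite: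
  fixes \<alpha> r :: real and p q :: ennreal
  assumes f: "f holomorphic_on UNIV" and p: "p > 0" and \<alpha>: "\<alpha> > 0" and q: "q > 0" "q \<noteq> \<infinity>"
    and fin: "fock_norm \<alpha> p q f < \<infinity>" and r: "r \<ge> 0"
  defines "Q \<equiv> enn2real q"
  shows "integral_mean p f r \<le> (8 * exp (\<alpha> * Q) / (\<alpha> * Q)) powr (1 / Q) *
    (1 + r) powr (- (1 / Q)) * exp (\<alpha> / 2 * r\<^sup>2) * enn2real (fock_norm \<alpha> p q f)"
proof -
  have Q: "Q > 0" using q by (simp add: Q_def enn2real_positive_iff top.not_eq_extremum)
  define I where "I = (\<integral>\<^sup>+ s\<in>{0..}. ennreal (integral_mean p f s powr Q * (\<alpha> * Q) *
      exp (- (\<alpha> * Q / 2) * s\<^sup>2) * s) \<partial>lborel)"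
  have norm: "fock_norm \<alpha> p q f = ennreal_powr I (1 / Q)"
    using q by (simp add: fock_norm_def I_def Q_def)
  \<comment> \<open>\<open>ennreal_powr\<close> sends infinity to infinity, so a finite norm forces
    a finite integral.\<close>
  then have I: "I < \<infinity>"
    using fin by (auto simp: ennreal_powr_def top.not_eq_extremum split: if_splits)
  then have norm': "enn2real (fock_norm \<alpha> p q f) = enn2real I powr (1 / Q)"
    by (simp add: norm ennreal_powr_def)
  define K where "K = 8 * exp (\<alpha> * Q) / (\<alpha> * Q)"
  have "K > 0" using \<alpha> Q by (simp add: K_def)
  define m where "m = integral_mean p f r"
  have "m \<ge> 0" unfolding m_def using f by (rule integral_mean_nonneg)
  have "m powr Q * exp (- (\<alpha> * Q / 2) * r\<^sup>2) \<le> K / (1 + r) * enn2real I"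
    using gaussian_mean_le_integral[OF f p \<alpha> Q r] I by (simp add: I_def K_def m_def)
  then have "(m powr Q * exp (- (\<alpha> * Q / 2) * r\<^sup>2)) powr (1 / Q) \<le> (K / (1 + r) * enn2real I) powr (1 / Q)"
    using Q by (intro powr_mono2) auto
  moreover have "(m powr Q * exp (- (\<alpha> * Q / 2) * r\<^sup>2)) powr (1 / Q) = m * exp (- (\<alpha> / 2 * r\<^sup>2))"
    using Q \<open>m \<ge> 0\<close> by (simp add: powr_mult powr_powr exp_powr_real)
  moreover have "(K / (1 + r) * enn2real I) powr (1 / Q) =
      K powr (1 / Q) * (1 + r) powr (- (1 / Q)) * enn2real I powr (1 / Q)"
    using \<open>K > 0\<close> r by (simp add: powr_mult powr_divide powr_minus field_simps)
  ultimately have "m * exp (- (\<alpha> / 2 * r\<^sup>2)) * exp (\<alpha> / 2 * r\<^sup>2) \<le>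
      K powr (1 / Q) * (1 + r) powr (- (1 / Q)) * enn2real I powr (1 / Q) * exp (\<alpha> / 2 * r\<^sup>2)"
    by (intro mult_right_mono) auto
  then show ?thesis
    by (simp add: norm' K_def m_def exp_minus mult_ac)
qed

text \<open>\<open>C\<close> is quantified before \<open>p\<close> and \<open>f\<close>, which
  expresses its dependence on \<open>\<alpha>\<close> and \<open>q\<close> alone. The quotient
  \<open>1 / q\<close> is formed in \<open>ennreal\<close>, where it is \<open>0\<close> at
  infinity.\<close>

theorem theorem1p1:
  fixes \<alpha> :: real and q :: ennreal
  assumes "\<alpha> > 0" and "q > 0"
  shows "\<exists>C::real. C > 0 \<and>
           (\<forall>p::ennreal. p > 0 \<longrightarrow>
             (\<forall>f \<in> mixed_fock_space \<alpha> p q. \<forall>r\<ge>0.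
               integral_mean p f r
                 \<le> C * (1 + r) powr (- enn2real (1 / q)) * exp (\<alpha> / 2 * r\<^sup>2)
                     * enn2real (fock_norm \<alpha> p q f)))"
proof (cases "q = \<infinity>")
  case True
  \<comment> \<open>At \<open>q = \<infinity>\<close> the power of \<open>1 + r\<close> has exponent
    \<open>0\<close>, and the supremum norm gives the bound with constant \<open>1\<close>.\<close>
  then show ?thesis
    using integral_mean_le_fock_norm_infinity
    by (intro exI[of _ 1]) (auto simp: mixed_fock_space_def)
next
  case False
  define Q where "Q = enn2real q"
  have Q: "Q > 0" using assms(2) False by (simp add: Q_def enn2real_positive_iff top.not_eq_extremum)
  have "q = ennreal Q" using False by (simp add: Q_def top.not_eq_extremum)
  then have "enn2real (1 / q) = 1 / Q"
    using Q by (simp add: divide_ennreal flip: ennreal_1)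
  moreover have "(8 * exp (\<alpha> * Q) / (\<alpha> * Q)) powr (1 / Q) > 0"
    using assms(1) Q by simp
  ultimately show ?thesis
    using integral_mean_le_fock_norm_finite[OF _ _ assms False]
    by (intro exI[of _ "(8 * exp (\<alpha> * Q) / (\<alpha> * Q)) powr (1 / Q)"])
       (auto simp: mixed_fock_space_def Q_def)
qed

end
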